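(* Let $p\ge 11$ be a prime. Let $c$ be an integer such that $2c\equiv -1\pmod p$ (i.e., $c=\frac{p-1}{2}$ in $\mathbb{Z}_p$). Define subsets of $\mathbb{Z}_p$ by $$B=\{0,1,c\},\qquad A=\mathbb{Z}_p\setminus\{-1,-c,-2\}.$$ Then $|A|=p-3$, $|B|=3$, $|A|+|B|=p$, and $$|A\widehat{+}B|=p-2.$$ Moreover, neither $A$ nor $B$ is an arithmetic progression.
   Context: $\mathbb{Z}_p=\mathbb{Z}/p\mathbb{Z}$ is the cyclic group of order $p$; integers are identified with their residue classes modulo $p$. For nonempty $A,B\subset\mathbb{Z}_p$, the restricted sumset is $A\widehat{+}B=\{a+b: a\in A,\ b\in B,\ a\neq b\}$. A subset of $\mathbb{Z}_p$ of size $m$ is an arithmetic progression if it has the form $\{a_0+id: 0\le i\le m-1\}$ for some $a_0,d\in\mathbb{Z}_p$ with $d\neq 0$. *)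

theory Defs
  imports "HOL-Number_Theory.Residues"
begin

definition restricted_sumset :: "('a, 'm) ring_scheme \<Rightarrow> 'a set \<Rightarrow> 'a set \<Rightarrow> 'a set"
  where "restricted_sumset R A B = {a \<oplus>\<^bsub>R\<^esub> b | a b. a \<in> A \<and> b \<in> B \<and> a \<noteq> b}"

definition arithmetic_progression :: "('a, 'm) ring_scheme \<Rightarrow> 'a set \<Rightarrow> bool"
  where "arithmetic_progression R S \<longleftrightarrow>
    (\<exists>a\<^sub>0 \<in> carrier R. \<exists>d \<in> carrier R. d \<noteq> \<zero>\<^bsub>R\<^esub> \<and>
      S = {a\<^sub>0 \<oplus>\<^bsub>R\<^esub> add_pow R i d | i::nat. i < card S})"

text \<open>
  The carrier of \<^term>\<open>residue_ring m\<close> is the set of canonical representatives \<open>{0..m - 1}\<close>,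
  so the residue class of an integer \<open>x\<close> is the element \<open>x mod m\<close>.
\<close>

definition residue_classes :: "int \<Rightarrow> int set \<Rightarrow> int set"
  where "residue_classes m X = (\<lambda>x. x mod m) ` X"

end

theory Submission
  imports Defs
begin

text \<open>
  A residue \<open>x\<close> lies outside the restricted sumset iff, for each \<open>b \<in> {0, 1, c}\<close>, either
  \<open>x - b \<in> {-1, -c, -2}\<close> or \<open>x = 2b\<close>; these three conditions leave exactly \<open>x \<in> {0, -1}\<close>.
  In an arithmetic progression of length three some element is the midpoint of the other two. This
  excludes \<open>B\<close>, and also \<open>A\<close>, because continuing a progression of length \<open>p - 3\<close> by three more
  terms yields three distinct residues outside it. Since \<open>2c = -1\<close>, every coincidence to be
  excluded says that \<open>p\<close> divides an integer \<open>k\<close> with \<open>0 < \<bar>k\<bar> \<le> 7\<close>.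
\<close>

lemma add_pow_residue_ring:
  assumes "1 < m"
  shows "add_pow (residue_ring m) (i::nat) d = (int i * d) mod m"
proof -
  interpret residues m "residue_ring m" by unfold_locales (use assms in simp_all)
  show ?thesis
  proof (induction i)
    case 0
    then show ?case by (simp add: add_pow_def nat_pow_def res_zero_eq)
  next
    case (Suc i)
    then show ?case by (simp add: res_add_eq mod_simps algebra_simps)
  qed
qed

lemma arithmetic_progression_residue_ringE:
  assumes "1 < m" and "arithmetic_progression (residue_ring m) S"
  obtains a d where "\<not> m dvd d" and "S = (\<lambda>i. (a + int i * d) mod m) ` {..<card S}"
proof -
  interpret residues m "residue_ring m" by unfold_locales (use assms(1) in simp_all)
  obtain a d where d: "d \<in> {0..m - 1}" "d \<noteq> 0"
    and S: "S = {(a + int i * d) mod m | i. i < card S}"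
    using assms(2) unfolding arithmetic_progression_def
    by (auto simp: res_zero_eq res_carrier_eq add_pow_residue_ring[OF assms(1)] res_add_eq mod_simps)
  have "\<not> m dvd d"
    using d zdvd_not_zless[of d m] by auto
  moreover from S have "S = (\<lambda>i. (a + int i * d) mod m) ` {..<card S}"
    by (auto simp: image_def)
  ultimately show ?thesis by (rule that)
qed

lemma mod_mem_residue_classes_iff:
  "u mod m \<in> residue_classes m X \<longleftrightarrow> (\<exists>x\<in>X. m dvd u - x)"
  by (auto simp: residue_classes_def image_iff mod_eq_dvd_iff)

lemma residue_classes_subset_carrier:
  assumes "1 < m"
  shows "residue_classes m X \<subseteq> carrier (residue_ring m)"
  using assms by (auto simp: residue_classes_def residue_ring_def)

lemma card_residue_classes_3:
  assumes "\<not> m dvd x - y" "\<not> m dvd x - z" "\<not> m dvd y - z"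
  shows "card (residue_classes m {x, y, z}) = 3"
  using assms by (simp add: residue_classes_def mod_eq_dvd_iff)

text \<open>As \<open>m\<close> is an odd prime, the three terms are pairwise incongruent, so they
  use each of \<open>x\<close>, \<open>y\<close>, \<open>z\<close> exactly once. The disjuncts name
  the one hit by the middle term.\<close>

lemma midpoint_in_three_residue_classes:
  fixes m :: int
  assumes "prime m" "\<not> m dvd 2" "\<not> m dvd d"
    and "a mod m \<in> residue_classes m {x, y, z}"
    and "(a + d) mod m \<in> residue_classes m {x, y, z}"
    and "(a + 2 * d) mod m \<in> residue_classes m {x, y, z}"
  shows "m dvd x + y - 2 * z \<or> m dvd x + z - 2 * y \<or> m dvd y + z - 2 * x"
proof -
  have two: "\<not> m dvd 2 * d"
    using assms(1-3) by (simp add: prime_dvd_mult_iff)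
  obtain u v w where uvw: "u \<in> {x, y, z}" "v \<in> {x, y, z}" "w \<in> {x, y, z}"
    and dvd: "m dvd a - u" "m dvd a + d - v" "m dvd a + 2 * d - w"
    using assms(4-6) unfolding mod_mem_residue_classes_iff by blast
  have "u \<noteq> v"
    using dvd_diff[OF dvd(2,1)] assms(3) by auto
  moreover have "v \<noteq> w"
    using dvd_diff[OF dvd(3,2)] assms(3) by auto
  moreover have "u \<noteq> w"
    using dvd_diff[OF dvd(3,1)] two by auto
  moreover have "m dvd u + w - 2 * v"
  proof -
    have "u + w - 2 * v = 2 * (a + d - v) - (a - u) - (a + 2 * d - w)" by simp
    then show ?thesis
      using dvd by (metis dvd_diff dvd_mult)
  qed
  ultimately show ?thesis
    using uvw by (auto simp: add.commute)
qed

text \<open>Solving \<open>a + y = x\<close> gives \<open>a = x - y\<close>, and then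
  \<open>a \<noteq> y\<close> becomes \<open>x \<noteq> 2 * y\<close> modulo \<open>m\<close>. Since
  \<open>A\<close> consists of canonical representatives, \<open>a\<close> is recovered as
  \<open>(x - y) mod m\<close>.\<close>

lemma mem_restricted_sumset_residue_ring_iff:
  assumes "1 < m" and "A \<subseteq> carrier (residue_ring m)"
  shows "x \<in> restricted_sumset (residue_ring m) A (residue_classes m Y) \<longleftrightarrow>
    x \<in> carrier (residue_ring m) \<and> (\<exists>y\<in>Y. (x - y) mod m \<in> A \<and> \<not> m dvd x - 2 * y)"
    (is "?L \<longleftrightarrow> ?R")
proof -
  interpret residues m "residue_ring m" by unfold_locales (use assms(1) in simp_all)
  show ?thesis
  proof
    assume ?L
    then obtain a y where a: "a \<in> A" "y \<in> Y" "a \<noteq> y mod m" and x: "x = (a + y mod m) mod m"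
      unfolding restricted_sumset_def residue_classes_def by (auto simp: res_add_eq)
    have amod: "a mod m = a"
      using a(1) assms(2) by (auto simp: res_carrier_eq)
    have "(x - y) mod m = a"
      unfolding x using amod by (simp add: mod_simps)
    moreover have "\<not> m dvd x - 2 * y"
    proof
      assume "m dvd x - 2 * y"
      then have "m dvd (x - y) - y" by (simp add: algebra_simps)
      then have "(x - y) mod m = y mod m" by (simp add: mod_eq_dvd_iff)
      with \<open>(x - y) mod m = a\<close> a(3) show False by simp
    qed
    moreover have "x \<in> carrier (residue_ring m)"
      unfolding x using assms(1) by (simp add: res_carrier_eq)
    ultimately show ?R using a by blast
  next
    assume ?R
    then obtain y where x: "x \<in> carrier (residue_ring m)"
      and y: "y \<in> Y" "(x - y) mod m \<in> A" "\<not> m dvd x - 2 * y" by blast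
    have "(x - y) mod m \<noteq> y mod m"
      using y(3) by (simp add: mod_eq_dvd_iff algebra_simps)
    moreover have "x = (x - y) mod m \<oplus>\<^bsub>residue_ring m\<^esub> y mod m"
      using x by (simp add: res_add_eq mod_simps res_carrier_eq)
    ultimately show ?L
      using y unfolding restricted_sumset_def residue_classes_def by blast
  qed
qed

theorem theorem2p3:
  fixes p :: nat and c :: int and A B :: "int set"
  assumes "prime p" and "p \<ge> 11"
    and "[2 * c = -1] (mod int p)"
    and "B = residue_classes (int p) {0, 1, c}"
    and "A = carrier (residue_ring (int p)) - residue_classes (int p) {-1, -c, -2}"
  shows "card A = p - 3 \<and> card B = 3 \<and> card A + card B = p
    \<and> card (restricted_sumset (residue_ring (int p)) A B) = p - 2
    \<and> \<not> arithmetic_progression (residue_ring (int p)) A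
    \<and> \<not> arithmetic_progression (residue_ring (int p)) B"
proof -
  let ?m = "int p" and ?R = "residue_ring (int p)"
  let ?C = "residue_classes (int p) {-1, -c, -2}"
  have m1: "1 < ?m" using assms(2) by simp
  have carrier: "carrier ?R = {0..?m - 1}" by (simp add: residue_ring_def)
  have two_c: "?m dvd 2 * c + 1"
    using assms(3) by (simp add: cong_iff_dvd_diff)
  have small: "\<not> ?m dvd k" if "k \<noteq> 0" "\<bar>k\<bar> < 11" for k
    using that assms(2) zdvd_not_zless[of "\<bar>k\<bar>" ?m] by auto
  \<comment> \<open>Doubling eliminates \<open>c\<close>: since \<open>2 * c\<close> is congruent to
    \<open>-1\<close>, \<open>2 * k\<close> is congruent to the small integer
    \<open>2 * t - s\<close>. Each later use supplies the coefficients \<open>s\<close> and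
    \<open>t\<close>.\<close>
  have lin: "\<not> ?m dvd k" if "k = s * c + t" "2 * t - s \<noteq> 0" "\<bar>2 * t - s\<bar> < 11" for k s t
  proof
    assume "?m dvd k"
    moreover have "2 * t - s = 2 * k - s * (2 * c + 1)"
      using that(1) by (simp add: algebra_simps)
    ultimately have "?m dvd 2 * t - s"
      using two_c by simp
    with that small show False by blast
  qed

  have cardB: "card B = 3"
    unfolding assms(4) by (rule card_residue_classes_3)
      (rule lin[of _ 0 "-1"] lin[of _ "-1" 0] lin[of _ "-1" 1]; simp)+
  have cardC: "card ?C = 3"
    by (rule card_residue_classes_3)
      (rule lin[of _ 1 "-1"] lin[of _ 0 1] lin[of _ "-1" 2]; simp)+
  have cardA: "card A = p - 3"
    unfolding assms(5)
    using card_Diff_subset[OF _ residue_classes_subset_carrier[OF m1, of "{-1, -c, -2}"]] cardC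
    by (simp add: carrier residue_classes_def)

  have memA: "u mod ?m \<in> A \<longleftrightarrow> \<not> (?m dvd u + 1 \<or> ?m dvd u + c \<or> ?m dvd u + 2)" for u
    unfolding assms(5) Diff_iff mod_mem_residue_classes_iff
    using m1 by (simp add: carrier)
  have sumset: "restricted_sumset ?R A B = carrier ?R - {0, ?m - 1}"
  proof (rule Set.set_eqI)
    fix x
    have eq0: "x = 0 \<longleftrightarrow> ?m dvd x" and eq1: "x = ?m - 1 \<longleftrightarrow> ?m dvd x + 1" if "x \<in> carrier ?R"
      using that zdvd_not_zless[of x ?m] zdvd_not_zless[of "x + 1" ?m] by (fastforce simp: carrier)+
    have "(\<exists>y\<in>{0, 1, c}. (x - y) mod ?m \<in> A \<and> \<not> ?m dvd x - 2 * y) \<longleftrightarrow>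
      \<not> ?m dvd x \<and> \<not> ?m dvd x + 1" (is "?E \<longleftrightarrow> ?N")
    proof
      assume ?E
      \<comment> \<open>The class of \<open>-1\<close> is missed because \<open>-1 - 0\<close> and
        \<open>-1 - 1\<close> were removed from \<open>A\<close> and \<open>-1\<close> is
        \<open>2 * c\<close>. The class of \<open>0\<close> is missed because it is
        \<open>2 * 0\<close> and both \<open>0 - 1\<close> and \<open>0 - c\<close> were
        removed.\<close>
      moreover have "?m dvd x - 2 * c" if "?m dvd x + 1"
        using dvd_diff[OF that two_c] by simp
      ultimately show ?N
        by (auto simp: memA add.commute[of 1 x])
    next
      assume N: ?N
      show ?E
      proof (rule ccontr)
        assume "\<not> ?E"
        \<comment> \<open>Given \<open>N\<close>, failure at \<open>y = 0\<close> leaves only the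
          classes of \<open>-c\<close> and \<open>-2\<close> for \<open>x\<close>, and failure at
          \<open>y = 1\<close> only those of \<open>1 - c\<close> and \<open>2\<close>. The four
          differences below show these pairs to be disjoint.\<close>
        then have "?m dvd x + c \<or> ?m dvd x + 2" "?m dvd x - 1 + c \<or> ?m dvd x - 2"
          using N by (auto simp: memA add.commute[of 1 x])
        moreover have "\<not> (?m dvd x + c \<and> ?m dvd x - 1 + c)"
          using dvd_diff[of ?m "x + c" "x - 1 + c"] lin[of "(x + c) - (x - 1 + c)" 0 1] by auto
        moreover have "\<not> (?m dvd x + c \<and> ?m dvd x - 2)"
          using dvd_diff[of ?m "x + c" "x - 2"] lin[of "(x + c) - (x - 2)" 1 2] by auto
        moreover have "\<not> (?m dvd x + 2 \<and> ?m dvd x - 1 + c)"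
          using dvd_diff[of ?m "x + 2" "x - 1 + c"] lin[of "(x + 2) - (x - 1 + c)" "-1" 3] by auto
        moreover have "\<not> (?m dvd x + 2 \<and> ?m dvd x - 2)"
          using dvd_diff[of ?m "x + 2" "x - 2"] lin[of "(x + 2) - (x - 2)" 0 4] by auto
        ultimately show False by blast
      qed
    qed
    then show "x \<in> restricted_sumset ?R A B \<longleftrightarrow> x \<in> carrier ?R - {0, ?m - 1}"
      unfolding assms(4)
      using mem_restricted_sumset_residue_ring_iff[OF m1, of A x "{0, 1, c}"] eq0 eq1 assms(5)
      by blast
  qed
  have cardS: "card (restricted_sumset ?R A B) = p - 2"
    unfolding sumset using m1 by (subst card_Diff_subset) (auto simp: carrier)

  have prime_m: "prime ?m" using assms(1) by simp
  have m2: "\<not> ?m dvd 2" using small by simp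
  have notB: "\<not> arithmetic_progression ?R B"
  proof
    assume "arithmetic_progression ?R B"
    then obtain a d where d: "\<not> ?m dvd d" and B: "B = (\<lambda>i. (a + int i * d) mod ?m) ` {..<3}"
      using arithmetic_progression_residue_ringE[OF m1, of B] cardB by metis
    have "(a + int i * d) mod ?m \<in> residue_classes ?m {0, 1, c}" if "i < 3" for i
      using B that assms(4) by blast
    from this[of 0] this[of 1] this[of 2]
    have "?m dvd 0 + 1 - 2 * c \<or> ?m dvd 0 + c - 2 * 1 \<or> ?m dvd 1 + c - 2 * 0"
      by (intro midpoint_in_three_residue_classes[OF prime_m m2 d]) simp_all
    then show False
      \<comment> \<open>Here \<open>2 * t - s\<close> takes the values 4, -5 and 1.\<close>
      using lin[of "0 + 1 - 2 * c" "-2" 1] lin[of "0 + c - 2 * 1" 1 "-2"]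
        lin[of "1 + c - 2 * 0" 1 1] by simp
  qed
  have notA: "\<not> arithmetic_progression ?R A"
  proof
    assume "arithmetic_progression ?R A"
    then obtain a d where d: "\<not> ?m dvd d" and A: "A = (\<lambda>i. (a + int i * d) mod ?m) ` {..<p - 3}"
      using arithmetic_progression_residue_ringE[OF m1, of A] cardA by metis
    \<comment> \<open>Agreement with an earlier term of index \<open>i < p - 3\<close> would make
      \<open>p\<close> divide \<open>(j - i) * d\<close>, although \<open>0 < j - i < p\<close> and
      \<open>d\<close> is nonzero modulo \<open>p\<close>.\<close>
    have outside: "(a + int j * d) mod ?m \<in> ?C" if "p - 3 \<le> j" "j < p" for j
    proof (rule ccontr)
      assume "(a + int j * d) mod ?m \<notin> ?C"
      then have "(a + int j * d) mod ?m \<in> A"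
        using m1 unfolding assms(5) by (simp add: carrier)
      then obtain i where i: "i < p - 3" "(a + int j * d) mod ?m = (a + int i * d) mod ?m"
        unfolding A by auto
      then have "?m dvd (int j - int i) * d"
        by (simp add: mod_eq_dvd_iff algebra_simps)
      then have "?m dvd int j - int i"
        using prime_m d by (simp add: prime_dvd_mult_iff)
      then show False
        using zdvd_not_zless[of "int j - int i" ?m] i(1) that by simp
    qed
    \<comment> \<open>The first term past the end of \<open>A\<close>: the terms with indices
      \<open>p - 3\<close>, \<open>p - 2\<close>, \<open>p - 1\<close> form a progression inside the
      complement.\<close>
    define e where "e = a + int (p - 3) * d"
    have e: "e + d = a + int (p - 2) * d" "e + 2 * d = a + int (p - 1) * d"
      using assms(2) by (simp_all add: e_def of_nat_diff algebra_simps)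
    have "e mod ?m \<in> ?C" "(e + d) mod ?m \<in> ?C" "(e + 2 * d) mod ?m \<in> ?C"
      unfolding e unfolding e_def by (rule outside; use assms(2) in linarith)+
    then have "?m dvd -1 + -c - 2 * -2 \<or> ?m dvd -1 + -2 - 2 * -c \<or> ?m dvd -c + -2 - 2 * -1"
      by (rule midpoint_in_three_residue_classes[OF prime_m m2 d])
    then show False
      \<comment> \<open>Here \<open>2 * t - s\<close> takes the values 7, -8 and 1.\<close>
      using lin[of "-1 + -c - 2 * -2" "-1" 3] lin[of "-1 + -2 - 2 * -c" 2 "-3"]
        lin[of "-c + -2 - 2 * -1" "-1" 0] by simp
  qed
  show ?thesis
    using cardA cardB cardS notA notB assms(2) by simp
qed

end
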